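(* Let $M$ and $N$ be Puiseux monoids (that is, submonoids of $(\mathbb{Q}_{\ge 0},+)$) such that $N$ is finitely generated, and let $M+N = \{m+n : m \in M \text{ and } n \in N\}$ be their internal sum inside $\mathbb{Q}$. Then the following statements hold. (1) If $M$ is atomic, then $M+N$ is atomic. (2) If $M$ is strongly atomic, then $M+N$ is strongly atomic.
   Context: A Puiseux monoid is an additive submonoid (containing $0$) of the nonnegative cone $\mathbb{Q}_{\ge 0}$ of $\mathbb{Q}$. All monoids are commutative and cancellative, written additively with identity $0$. For a monoid $M$, $\mathcal{U}(M)$ denotes its group of invertible elements (for a Puiseux monoid, $\mathcal{U}(M)=\{0\}$). For $b,c \in M$, $c$ divides $b$ in $M$, written $c \mid_M b$, if $b = c+d$ for some $d \in M$. A non-invertible element $a \in M$ is an atom if, for all $b,c \in M$, $a = b+c$ implies $b \in \mathcal{U}(M)$ or $c \in \mathcal{U}(M)$. An element of $M$ is atomic if it is invertible or can be written as a sum of finitely many (possibly repeated) atoms of $M$. The monoid $M$ is atomic if every element of $M$ is atomic. A maximal common divisor of a nonempty subset $S \subseteq M$ is an element $d \in M$ that divides in $M$ every element of $S$ and is such that the only common divisors in $M$ of the set $\{m \in M : m + d \in S\}$ are the invertible elements of $M$. The monoid $M$ is $2$-MCD if any two elements of $M$ have a maximal common divisor (i.e., for all $x,y\in M$ the set $\{x,y\}$ has a maximal common divisor). The monoid $M$ is strongly atomic if it is both atomic and $2$-MCD. *)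

theory Defs
  imports Complex_Main "HOL-Algebra.Divisibility" "HOL-Library.Set_Algebras"
begin

section \<open>Atomicity and maximal common divisors in a commutative cancellative monoid\<close>

text \<open>The notions below are meant for monoids satisfying \<^locale>\<open>comm_monoid_cancel\<close>. As in
  \<^theory>\<open>HOL-Algebra.Divisibility\<close>, \<^const>\<open>factor\<close> does not require the divisor to lie in the
  carrier, so membership is stated separately. The library's \<^const>\<open>irreducible\<close> is phrased through
  proper factors; \<open>atom\<close> is the condition on decompositions into two elements.\<close>

definition atom :: "('a, 'b) monoid_scheme \<Rightarrow> 'a \<Rightarrow> bool"
  where "atom G a \<longleftrightarrow> a \<in> carrier G \<and> a \<notin> Units G \<and>
    (\<forall>b\<in>carrier G. \<forall>c\<in>carrier G. a = b \<otimes>\<^bsub>G\<^esub> c \<longrightarrow> b \<in> Units G \<or> c \<in> Units G)"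

definition atomic_element :: "('a, 'b) monoid_scheme \<Rightarrow> 'a \<Rightarrow> bool"
  where "atomic_element G x \<longleftrightarrow>
    x \<in> Units G \<or> (\<exists>as. (\<forall>a\<in>set as. atom G a) \<and> x = foldr (\<otimes>\<^bsub>G\<^esub>) as \<one>\<^bsub>G\<^esub>)"

definition atomic_monoid :: "('a, 'b) monoid_scheme \<Rightarrow> bool"
  where "atomic_monoid G \<longleftrightarrow> (\<forall>x\<in>carrier G. atomic_element G x)"

definition common_divisor :: "('a, 'b) monoid_scheme \<Rightarrow> 'a set \<Rightarrow> 'a \<Rightarrow> bool"
  where "common_divisor G S d \<longleftrightarrow> d \<in> carrier G \<and> (\<forall>s\<in>S. d divides\<^bsub>G\<^esub> s)"

definition maximal_common_divisor :: "('a, 'b) monoid_scheme \<Rightarrow> 'a set \<Rightarrow> 'a \<Rightarrow> bool"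
  where "maximal_common_divisor G S d \<longleftrightarrow>
    S \<noteq> {} \<and> S \<subseteq> carrier G \<and> common_divisor G S d \<and>
    (\<forall>c. common_divisor G {m \<in> carrier G. m \<otimes>\<^bsub>G\<^esub> d \<in> S} c \<longrightarrow> c \<in> Units G)"

definition two_MCD :: "('a, 'b) monoid_scheme \<Rightarrow> bool"
  where "two_MCD G \<longleftrightarrow>
    (\<forall>x\<in>carrier G. \<forall>y\<in>carrier G. \<exists>d. maximal_common_divisor G {x, y} d)"

definition strongly_atomic :: "('a, 'b) monoid_scheme \<Rightarrow> bool"
  where "strongly_atomic G \<longleftrightarrow> atomic_monoid G \<and> two_MCD G"

definition finitely_generated_monoid :: "('a, 'b) monoid_scheme \<Rightarrow> bool"
  where "finitely_generated_monoid G \<longleftrightarrow>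
    (\<exists>A. finite A \<and> A \<subseteq> carrier G \<and> carrier G = (\<lambda>H. submonoid H G) hull A)"


section \<open>Puiseux monoids\<close>

definition rat_add_monoid :: "rat set \<Rightarrow> rat monoid"
  where "rat_add_monoid M = \<lparr>carrier = M, monoid.mult = (+), one = 0\<rparr>"

definition puiseux_monoid :: "rat set \<Rightarrow> bool"
  where "puiseux_monoid M \<longleftrightarrow> submonoid M (rat_add_monoid {0..})"

lemma puiseux_monoid_iff:
  "puiseux_monoid M \<longleftrightarrow> M \<subseteq> {0..} \<and> 0 \<in> M \<and> (\<forall>x\<in>M. \<forall>y\<in>M. x + y \<in> M)"
  unfolding puiseux_monoid_def submonoid_def rat_add_monoid_def by auto

lemma comm_monoid_cancel_puiseux:
  assumes "puiseux_monoid M"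
  shows "comm_monoid_cancel (rat_add_monoid M)"
proof (rule comm_monoid_cancelI)
  show "comm_monoid (rat_add_monoid M)"
    using assms by (intro comm_monoidI) (simp_all add: rat_add_monoid_def puiseux_monoid_iff)
qed (simp add: rat_add_monoid_def)

lemma Units_puiseux:
  assumes "puiseux_monoid M"
  shows "Units (rat_add_monoid M) = {0}"
proof (intro Set.set_eqI iffI)
  fix y assume "y \<in> Units (rat_add_monoid M)"
  then obtain x where "y \<in> M" "x \<in> M" "x + y = 0"
    unfolding Units_def by (simp add: rat_add_monoid_def) blast
  moreover from this have "0 \<le> x" "0 \<le> y"
    using assms unfolding puiseux_monoid_iff by (auto dest: subsetD)
  ultimately show "y \<in> {0}" by simp
next
  fix y :: rat assume "y \<in> {0}"
  moreover have "0 \<in> M"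
    using assms unfolding puiseux_monoid_iff by blast
  ultimately show "y \<in> Units (rat_add_monoid M)"
    unfolding Units_def by (simp add: rat_add_monoid_def bexI[of _ 0])
qed

lemma puiseux_monoid_plus:
  assumes "puiseux_monoid M" "puiseux_monoid N"
  shows "puiseux_monoid (M + N)"
  unfolding puiseux_monoid_iff
proof (intro conjI ballI subsetI)
  have M: "M \<subseteq> {0..}" "0 \<in> M" "\<And>x y. x \<in> M \<Longrightarrow> y \<in> M \<Longrightarrow> x + y \<in> M"
    and N: "N \<subseteq> {0..}" "0 \<in> N" "\<And>x y. x \<in> N \<Longrightarrow> y \<in> N \<Longrightarrow> x + y \<in> N"
    using assms unfolding puiseux_monoid_iff by blast+
  show "0 \<in> M + N"
    using set_plus_intro[OF M(2) N(2)] by simp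
  show "x \<in> {0..}" if x: "x \<in> M + N" for x
  proof -
    obtain a b where "x = a + b" "a \<in> M" "b \<in> N"
      using x by (rule set_plus_elim)
    moreover from this have "0 \<le> a" "0 \<le> b"
      using M(1) N(1) by auto
    ultimately show ?thesis by simp
  qed
  show "x + y \<in> M + N" if xy: "x \<in> M + N" "y \<in> M + N" for x y
  proof -
    obtain a b where x: "x = a + b" "a \<in> M" "b \<in> N"
      using xy(1) by (rule set_plus_elim)
    obtain c d where y: "y = c + d" "c \<in> M" "d \<in> N"
      using xy(2) by (rule set_plus_elim)
    have "(a + c) + (b + d) \<in> M + N"
      using M(3)[OF x(2) y(2)] N(3)[OF x(3) y(3)] by (rule set_plus_intro)
    then show ?thesis
      by (simp only: x(1) y(1) ac_simps)
  qed
qed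

end

theory Submission
  imports Defs
begin

text \<open>Adding the generators of \<open>N\<close> one at a time, it suffices to treat \<open>P = M + \<nat> n\<close>
  with \<open>n > 0\<close>.

  Atomicity: unless \<open>n \<in> M\<close> (and then \<open>P = M\<close>), \<open>n\<close> is an atom of \<open>P\<close>. An atom of \<open>M\<close> that
  splits in \<open>P\<close> is divisible by \<open>n\<close> in \<open>P\<close>, so induction on \<open>\<lfloor>x / n\<rfloor>\<close> applies.

  Maximal common divisors of \<open>x, y \<in> P\<close>: after subtracting copies of \<open>n\<close>, all common divisors
  lie in \<open>M\<close>. The set \<open>F\<close> of pairs \<open>(s, t)\<close> with \<open>x - s n \<in> M\<close> and \<open>y - t n \<in> M\<close> is finite
  and can only shrink when a common divisor is subtracted. Subtracting a maximal common divisor in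
  \<open>M\<close> of \<open>x - s n\<close> and \<open>y - t n\<close> for some \<open>(s, t) \<in> F\<close> ensures that any further nonzero
  subtraction removes \<open>(s, t)\<close> from \<open>F\<close>, so the process terminates.\<close>

section \<open>Atoms, atomic elements and maximal common divisors in Puiseux monoids\<close>

lemma puiseux_monoidD:
  assumes "puiseux_monoid M"
  shows "0 \<in> M" and "x \<in> M \<Longrightarrow> y \<in> M \<Longrightarrow> x + y \<in> M" and "x \<in> M \<Longrightarrow> 0 \<le> x"
  using assms unfolding puiseux_monoid_iff by auto

lemma atom_puiseux_iff:
  assumes "puiseux_monoid M"
  shows "atom (rat_add_monoid M) a \<longleftrightarrow>
    a \<in> M \<and> a \<noteq> 0 \<and> (\<forall>b\<in>M. \<forall>c\<in>M. a = b + c \<longrightarrow> b = 0 \<or> c = 0)"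
  unfolding atom_def Units_puiseux[OF assms] by (simp add: rat_add_monoid_def)

lemma atomic_element_puiseux_iff:
  assumes "puiseux_monoid M"
  shows "atomic_element (rat_add_monoid M) x \<longleftrightarrow>
    (\<exists>as. (\<forall>a\<in>set as. atom (rat_add_monoid M) a) \<and> x = sum_list as)"
proof -
  have "foldr (\<otimes>\<^bsub>rat_add_monoid M\<^esub>) as \<one>\<^bsub>rat_add_monoid M\<^esub> = sum_list as" for as
    by (induction as) (simp_all add: rat_add_monoid_def)
  moreover have "\<exists>as. (\<forall>a\<in>set as. atom (rat_add_monoid M) a) \<and> 0 = sum_list as"
    by (rule exI[of _ "[]"]) simp
  ultimately show ?thesis
    unfolding atomic_element_def Units_puiseux[OF assms] by auto
qed

lemma atomic_element_atom:
  assumes "puiseux_monoid M" and "atom (rat_add_monoid M) a"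
  shows "atomic_element (rat_add_monoid M) a"
  unfolding atomic_element_puiseux_iff[OF assms(1)]
  by (rule exI[of _ "[a]"]) (simp add: assms(2))

lemma atomic_element_add:
  assumes "puiseux_monoid M"
    and "atomic_element (rat_add_monoid M) x" and "atomic_element (rat_add_monoid M) y"
  shows "atomic_element (rat_add_monoid M) (x + y)"
proof -
  obtain as bs where
    "\<forall>a\<in>set as. atom (rat_add_monoid M) a" "x = sum_list as"
    "\<forall>b\<in>set bs. atom (rat_add_monoid M) b" "y = sum_list bs"
    using assms(2,3) unfolding atomic_element_puiseux_iff[OF assms(1)] by blast
  then show ?thesis
    unfolding atomic_element_puiseux_iff[OF assms(1)]
    by (intro exI[of _ "as @ bs"]) auto
qed

lemma atomic_element_sum_list:
  assumes "puiseux_monoid M" and "\<And>x. x \<in> set xs \<Longrightarrow> atomic_element (rat_add_monoid M) x"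
  shows "atomic_element (rat_add_monoid M) (sum_list xs)"
  using assms(2)
proof (induction xs)
  case Nil
  show ?case by (simp add: atomic_element_def Units_puiseux[OF assms(1)])
next
  case (Cons x xs)
  then show ?case by (simp add: atomic_element_add[OF assms(1)])
qed

text \<open>Differences exist in the rationals, so divisibility becomes membership of a difference,
  and the set of cofactors in the definition is \<open>{x - d, y - d}\<close>.\<close>

lemma maximal_common_divisor_puiseux_iff:
  assumes "puiseux_monoid M"
  shows "maximal_common_divisor (rat_add_monoid M) {x, y} d \<longleftrightarrow>
    x \<in> M \<and> y \<in> M \<and> d \<in> M \<and> x - d \<in> M \<and> y - d \<in> M \<and>
    (\<forall>c\<in>M. x - d - c \<in> M \<longrightarrow> y - d - c \<in> M \<longrightarrow> c = 0)"
proof -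
  have cd: "common_divisor (rat_add_monoid M) S c \<longleftrightarrow> c \<in> M \<and> (\<forall>s\<in>S. s - c \<in> M)" for S c
  proof -
    have "c divides\<^bsub>rat_add_monoid M\<^esub> s \<longleftrightarrow> s - c \<in> M" for s
    proof -
      have "(\<exists>e\<in>M. s = c + e) \<longleftrightarrow> s - c \<in> M"
        by (metis add_diff_cancel_left' add.commute diff_add_cancel)
      then show ?thesis by (simp add: factor_def rat_add_monoid_def)
    qed
    then show ?thesis by (simp add: common_divisor_def rat_add_monoid_def)
  qed
  have "{m \<in> M. m + d \<in> {x, y}} = {x - d, y - d}" if "x - d \<in> M" "y - d \<in> M"
    using that by (auto simp: algebra_simps)
  then have "common_divisor (rat_add_monoid M) {m \<in> M. m + d \<in> {x, y}} c \<longleftrightarrow>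
      c \<in> M \<and> x - d - c \<in> M \<and> y - d - c \<in> M" if "x - d \<in> M" "y - d \<in> M" for c
    using that by (simp add: cd)
  moreover have "carrier (rat_add_monoid M) = M" "a \<otimes>\<^bsub>rat_add_monoid M\<^esub> b = a + b" for a b
    by (simp_all add: rat_add_monoid_def)
  ultimately show ?thesis
    unfolding maximal_common_divisor_def Units_puiseux[OF assms] cd
    by auto
qed

text \<open>Common divisors may thus be split off one after another: removing \<open>e\<close> and
  then \<open>d\<close> leaves the same pair as removing \<open>e + d\<close> at once.\<close>

lemma maximal_common_divisor_puiseux_shift:
  assumes P: "puiseux_monoid P" and "x \<in> P" "y \<in> P" "e \<in> P"
    and "maximal_common_divisor (rat_add_monoid P) {x - e, y - e} d"
  shows "maximal_common_divisor (rat_add_monoid P) {x, y} (e + d)"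
  using assms(2-) puiseux_monoidD(2)[OF P]
  unfolding maximal_common_divisor_puiseux_iff[OF P] by (simp add: diff_diff_eq add.assoc)

section \<open>Adjoining one generator: the sum of \<open>M\<close> and the multiples of
  \<open>n\<close>\<close>

definition multiples :: "rat \<Rightarrow> rat set"
  where "multiples n = range (\<lambda>i::nat. of_nat i * n)"

lemma puiseux_monoid_multiples:
  assumes "0 \<le> n"
  shows "puiseux_monoid (multiples n)"
proof -
  have "of_nat i * n + of_nat j * n \<in> multiples n" for i j
    unfolding multiples_def by (metis distrib_right of_nat_add rangeI)
  moreover have "0 \<in> multiples n"
    unfolding multiples_def by (rule range_eqI[of _ _ 0]) simp
  ultimately show ?thesis
    using assms unfolding puiseux_monoid_iff by (auto simp: multiples_def)
qed

lemma mem_plus_multiples_iff: "x \<in> M + multiples n \<longleftrightarrow> (\<exists>i. x - of_nat i * n \<in> M)"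
proof
  assume "x \<in> M + multiples n"
  then obtain a i where "x = a + of_nat i * n" "a \<in> M"
    by (auto simp: multiples_def elim!: set_plus_elim)
  then show "\<exists>i. x - of_nat i * n \<in> M" by (intro exI[of _ i]) simp
next
  assume "\<exists>i. x - of_nat i * n \<in> M"
  then obtain i where "x - of_nat i * n \<in> M" ..
  then have "(x - of_nat i * n) + of_nat i * n \<in> M + multiples n"
    by (rule set_plus_intro) (auto simp: multiples_def)
  then show "x \<in> M + multiples n" by simp
qed

text \<open>A representation of \<open>x\<close> either uses no copy of \<open>n\<close> or lets one
  copy be removed. The two cases may overlap.\<close>

lemma mem_plus_multiples_cases:
  assumes "x \<in> M + multiples n"
  obtains "x \<in> M" | "x - n \<in> M + multiples n"
proof -
  obtain i where i: "x - of_nat i * n \<in> M"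
    using assms unfolding mem_plus_multiples_iff ..
  show thesis
  proof (cases i)
    case 0
    then show ?thesis using i that(1) by simp
  next
    case (Suc j)
    then have "x - n - of_nat j * n \<in> M" using i by (simp add: algebra_simps)
    then show ?thesis using that(2) unfolding mem_plus_multiples_iff by blast
  qed
qed

lemma subset_plus_multiples: "M \<subseteq> M + multiples n"
  unfolding mem_plus_multiples_iff subset_iff by (auto intro: exI[of _ 0])

lemma plus_multiples_absorb:
  assumes M: "puiseux_monoid M" and "n \<in> M"
  shows "M + multiples n = M"
proof
  have "of_nat i * n \<in> M" for i
    by (induction i) (simp_all add: distrib_right puiseux_monoidD[OF M] assms(2))
  then show "M + multiples n \<subseteq> M"
    by (auto simp: multiples_def puiseux_monoidD(2)[OF M] elim!: set_plus_elim)
qed (rule subset_plus_multiples)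

text \<open>This makes the floor of \<open>x / n\<close> a measure for inductions that remove copies
  of \<open>n\<close>. The bound \<open>n \<le> x\<close> makes the larger floor at least 1, so
  truncation by \<open>nat\<close> keeps the inequality strict.\<close>

lemma nat_floor_diff_less:
  fixes n x :: rat
  assumes "0 < n" "n \<le> x"
  shows "nat \<lfloor>(x - n) / n\<rfloor> < nat \<lfloor>x / n\<rfloor>"
proof -
  have "(x - n) / n = x / n - 1" using assms by (simp add: diff_divide_distrib)
  moreover have "1 \<le> x / n" using assms by simp
  ultimately show ?thesis by simp
qed

lemma finite_multiples_mem:
  assumes "puiseux_monoid M" and "0 < n"
  shows "finite {i::nat. x - of_nat i * n \<in> M}"
proof (rule finite_subset)
  show "{i::nat. x - of_nat i * n \<in> M} \<subseteq> {..nat \<lfloor>x / n\<rfloor>}"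
  proof
    fix i :: nat assume "i \<in> {i. x - of_nat i * n \<in> M}"
    then have "0 \<le> x - of_nat i * n" using puiseux_monoidD(3)[OF assms(1)] by blast
    then have "of_nat i \<le> x / n" using assms(2) by (simp add: pos_le_divide_eq)
    then have "int i \<le> \<lfloor>x / n\<rfloor>" by (simp add: le_floor_iff)
    then show "i \<in> {..nat \<lfloor>x / n\<rfloor>}" by simp
  qed
qed simp

section \<open>Atomicity after adjoining one generator\<close>

lemma atom_plus_multiples:
  assumes M: "puiseux_monoid M" and n: "0 < n" "n \<notin> M"
  shows "atom (rat_add_monoid (M + multiples n)) n"
proof -
  define P where "P = M + multiples n"
  have P: "puiseux_monoid P"
    unfolding P_def using M n by (intro puiseux_monoid_plus puiseux_monoid_multiples) auto
  \<comment> \<open>No copy of \<open>n\<close> fits below \<open>n\<close>. Both parts of a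
    nontrivial splitting of \<open>n\<close> would therefore lie in \<open>M\<close>, and so would
    \<open>n\<close>.\<close>
  have small: "z \<in> M" if "z \<in> P" "z < n" for z
    using that(1) unfolding P_def
  proof (cases rule: mem_plus_multiples_cases)
    case 2
    then show ?thesis using puiseux_monoidD(3)[OF P, of "z - n"] that(2) by (simp add: P_def)
  qed
  have "b = 0 \<or> c = 0" if bc: "b \<in> P" "c \<in> P" "n = b + c" for b c
  proof (rule ccontr)
    assume "\<not> (b = 0 \<or> c = 0)"
    then have "b < n" "c < n"
      using bc puiseux_monoidD(3)[OF P bc(1)] puiseux_monoidD(3)[OF P bc(2)] by auto
    then have "n \<in> M" using bc small puiseux_monoidD(2)[OF M] by simp
    then show False using n by simp
  qed
  moreover have "n - of_nat 1 * n \<in> M" by (simp add: puiseux_monoidD(1)[OF M])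
  then have "n \<in> P" unfolding P_def mem_plus_multiples_iff ..
  ultimately show ?thesis
    using n unfolding P_def[symmetric] atom_puiseux_iff[OF P] by auto
qed

lemma atomic_monoid_plus_multiples:
  assumes M: "puiseux_monoid M" and "0 \<le> n" and at: "atomic_monoid (rat_add_monoid M)"
  shows "atomic_monoid (rat_add_monoid (M + multiples n))"
proof (cases "n \<in> M")
  case True
  then show ?thesis using at by (simp add: plus_multiples_absorb[OF M])
next
  case False
  with \<open>0 \<le> n\<close> have n: "0 < n" using puiseux_monoidD(1)[OF M] by (cases "n = 0") auto
  define P where "P = M + multiples n"
  have P: "puiseux_monoid P"
    unfolding P_def using M n by (intro puiseux_monoid_plus puiseux_monoid_multiples) auto
  have MP: "M \<subseteq> P" unfolding P_def by (rule subset_plus_multiples)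
  have n_atomic: "atomic_element (rat_add_monoid P) n"
    using atom_plus_multiples[OF M n False] unfolding P_def[symmetric]
    by (rule atomic_element_atom[OF P])
  have "atomic_element (rat_add_monoid P) x" if "x \<in> P" for x
    using that
  proof (induction "nat \<lfloor>x / n\<rfloor>" arbitrary: x rule: less_induct)
    case less
    \<comment> \<open>Stated for every \<open>z \<le> x\<close>, since it is applied to the atoms of
      \<open>M\<close> that occur in \<open>x\<close> as well as to \<open>x\<close> itself.\<close>
    have descend: "atomic_element (rat_add_monoid P) z"
      if z: "z - n \<in> P" "z \<le> x" for z
    proof -
      have "n \<le> z" using puiseux_monoidD(3)[OF P z(1)] by simp
      then have "nat \<lfloor>(z - n) / n\<rfloor> < nat \<lfloor>z / n\<rfloor>" using n by (intro nat_floor_diff_less)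
      also have "\<dots> \<le> nat \<lfloor>x / n\<rfloor>"
        using z(2) n by (intro nat_mono floor_mono divide_right_mono) auto
      finally have "atomic_element (rat_add_monoid P) (z - n)" using z(1) by (rule less.hyps)
      then show ?thesis using atomic_element_add[OF P _ n_atomic, of "z - n"] by simp
    qed
    from less.prems show ?case
      unfolding P_def
    proof (cases rule: mem_plus_multiples_cases)
      case 1
      then have "atomic_element (rat_add_monoid M) x"
        using at by (simp add: atomic_monoid_def rat_add_monoid_def)
      then obtain as where as: "\<forall>a\<in>set as. atom (rat_add_monoid M) a" "x = sum_list as"
        unfolding atomic_element_puiseux_iff[OF M] by blast
      have "atomic_element (rat_add_monoid P) a" if a: "a \<in> set as" for a
      proof (cases "atom (rat_add_monoid P) a")
        case True
        then show ?thesis by (rule atomic_element_atom[OF P])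
      next
        case False
        have aM: "atom (rat_add_monoid M) a" using as a by blast
        then obtain b c where bc: "b \<in> P" "c \<in> P" "a = b + c" "b \<noteq> 0" "c \<noteq> 0"
          using False MP unfolding atom_puiseux_iff[OF P] atom_puiseux_iff[OF M] by blast
        \<comment> \<open>As \<open>a\<close> does not split in \<open>M\<close>, one of the two
          parts uses a copy of \<open>n\<close>; removing that copy shows that \<open>n\<close>
          divides \<open>a\<close> in \<open>P\<close>.\<close>
        have "b \<notin> M \<or> c \<notin> M"
          using aM bc unfolding atom_puiseux_iff[OF M] by blast
        then have "b - n \<in> P \<or> c - n \<in> P"
          using bc(1,2) unfolding P_def by (blast elim: mem_plus_multiples_cases)
        then have "(b - n) + c \<in> P \<or> b + (c - n) \<in> P"
          using bc(1,2) puiseux_monoidD(2)[OF P] by blast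
        then have "a - n \<in> P" using bc(3) by (simp add: algebra_simps)
        moreover have "0 \<le> z" if "z \<in> set as" for z
          using as(1) that puiseux_monoidD(3)[OF M] unfolding atom_puiseux_iff[OF M] by blast
        then have "a \<le> x" unfolding as(2) using a by (intro member_le_sum_list) auto
        ultimately show ?thesis by (rule descend)
      qed
      then show "atomic_element (rat_add_monoid (M + multiples n)) x"
        unfolding as(2) P_def[symmetric] by (rule atomic_element_sum_list[OF P])
    next
      case 2
      then show "atomic_element (rat_add_monoid (M + multiples n)) x"
        using descend[of x] by (simp add: P_def)
    qed
  qed
  then show ?thesis
    unfolding P_def[symmetric] atomic_monoid_def by (simp add: rat_add_monoid_def)
qed

section \<open>Maximal common divisors after adjoining one generator\<close>

lemma two_MCD_puiseux_iff:
  "two_MCD (rat_add_monoid M) \<longleftrightarrow>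
    (\<forall>x\<in>M. \<forall>y\<in>M. \<exists>d. maximal_common_divisor (rat_add_monoid M) {x, y} d)"
  unfolding two_MCD_def by (simp add: rat_add_monoid_def)

lemma two_MCD_plus_multiples:
  assumes M: "puiseux_monoid M" and "0 \<le> n" and mcd: "two_MCD (rat_add_monoid M)"
  shows "two_MCD (rat_add_monoid (M + multiples n))"
proof (cases "n \<in> M")
  case True
  then show ?thesis using mcd by (simp add: plus_multiples_absorb[OF M])
next
  case False
  with \<open>0 \<le> n\<close> have n: "0 < n" using puiseux_monoidD(1)[OF M] by (cases "n = 0") auto
  define P where "P = M + multiples n"
  have P: "puiseux_monoid P"
    unfolding P_def using M n by (intro puiseux_monoid_plus puiseux_monoid_multiples) auto
  have MP: "M \<subseteq> P" unfolding P_def by (rule subset_plus_multiples)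
  have "n - of_nat 1 * n \<in> M" by (simp add: puiseux_monoidD(1)[OF M])
  then have nP: "n \<in> P" unfolding P_def mem_plus_multiples_iff ..
  define F where
    "F x y = {s::nat. x - of_nat s * n \<in> M} \<times> {t::nat. y - of_nat t * n \<in> M}" for x y
  have finF: "finite (F x y)" for x y
    unfolding F_def by (intro finite_cartesian_product finite_multiples_mem[OF M n])
  \<comment> \<open>Adding \<open>d\<close> back stays inside \<open>M\<close>, so representations
    of the smaller pair are also representations of the larger one.\<close>
  have F_diff: "F (x - d) (y - d) \<subseteq> F x y" if "d \<in> M" for x y d
  proof -
    have "z - of_nat i * n \<in> M" if "z - d - of_nat i * n \<in> M" for z and i :: nat
      using puiseux_monoidD(2)[OF M that \<open>d \<in> M\<close>] by (simp add: algebra_simps)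
    then show ?thesis unfolding F_def by blast
  qed
  \<comment> \<open>The third assumption says that \<open>n\<close> is not a common divisor of
    \<open>x\<close> and \<open>y\<close> in \<open>P\<close>; this is what forces common divisors
    into \<open>M\<close>.\<close>
  have no_n: "\<exists>d. maximal_common_divisor (rat_add_monoid P) {x, y} d"
    if "x \<in> P" "y \<in> P" "\<not> (x - n \<in> P \<and> y - n \<in> P)" for x y
    using that
  proof (induction "card (F x y)" arbitrary: x y rule: less_induct)
    case less
    obtain s t where st: "x - of_nat s * n \<in> M" "y - of_nat t * n \<in> M"
      using less.prems(1,2) unfolding P_def mem_plus_multiples_iff by blast
    then obtain d where d: "maximal_common_divisor (rat_add_monoid M)
        {x - of_nat s * n, y - of_nat t * n} d"
      using mcd unfolding two_MCD_puiseux_iff by blast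
    then have dM: "d \<in> M"
      and sd: "x - d - of_nat s * n \<in> M" and td: "y - d - of_nat t * n \<in> M"
      and d_max: "\<And>c. c \<in> M \<Longrightarrow> x - d - c - of_nat s * n \<in> M \<Longrightarrow>
        y - d - c - of_nat t * n \<in> M \<Longrightarrow> c = 0"
      unfolding maximal_common_divisor_puiseux_iff[OF M] by (simp_all add: algebra_simps)
    have xyd: "x - d \<in> P" "y - d \<in> P"
      using sd td unfolding P_def mem_plus_multiples_iff by blast+
    show ?case
    proof (cases "maximal_common_divisor (rat_add_monoid P) {x, y} d")
      case True
      then show ?thesis ..
    next
      case False
      then obtain c where c: "c \<in> P" "x - d - c \<in> P" "y - d - c \<in> P" "c \<noteq> 0"
        using dM MP less.prems(1,2) xyd unfolding maximal_common_divisor_puiseux_iff[OF P] by blast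
      have dP: "d \<in> P" using dM MP by blast
      \<comment> \<open>The assumption on \<open>n\<close> survives the removal of \<open>e\<close>,
        because \<open>e\<close> could be added back.\<close>
      have not_n: "\<not> (x - e - n \<in> P \<and> y - e - n \<in> P)" if "e \<in> P" for e
      proof
        assume "x - e - n \<in> P \<and> y - e - n \<in> P"
        then have "x - e - n + e \<in> P" "y - e - n + e \<in> P"
          using that puiseux_monoidD(2)[OF P] by blast+
        then show False using less.prems(3) by (simp add: algebra_simps)
      qed
      \<comment> \<open>Otherwise \<open>n\<close> divides \<open>c\<close> in \<open>P\<close>,
        hence divides both \<open>x - d\<close> and \<open>y - d\<close>.\<close>
      have "c \<in> M"
      proof (rule ccontr)
        assume "c \<notin> M"
        then have "c - n \<in> P" using c(1) unfolding P_def by (blast elim: mem_plus_multiples_cases)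
        then have "x - d - c + (c - n) \<in> P" "y - d - c + (c - n) \<in> P"
          using c(2,3) puiseux_monoidD(2)[OF P] by blast+
        moreover have "z - d - c + (c - n) = z - d - n" for z by simp
        ultimately show False using not_n[OF dP] by metis
      qed
      define e where "e = d + c"
      have eM: "e \<in> M" unfolding e_def using dM \<open>c \<in> M\<close> by (rule puiseux_monoidD(2)[OF M])
      then have eP: "e \<in> P" using MP by blast
      have "(s, t) \<in> F x y" using st by (simp add: F_def)
      \<comment> \<open>If the pair survived, \<open>c\<close> would be a common divisor in
        \<open>M\<close> of what remains after \<open>d\<close> was removed, and the choice of
        \<open>d\<close> would give \<open>c = 0\<close>.\<close>
      moreover have "(s, t) \<notin> F (x - e) (y - e)"
        using d_max[OF \<open>c \<in> M\<close>] c(4) by (auto simp: F_def e_def diff_diff_eq)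
      ultimately have "F (x - e) (y - e) \<subset> F x y" using F_diff[OF eM, of x y] by blast
      then have "card (F (x - e) (y - e)) < card (F x y)" by (rule psubset_card_mono[OF finF])
      moreover have "x - e \<in> P" "y - e \<in> P" using c(2,3) by (simp_all add: e_def diff_diff_eq)
      ultimately obtain d' where "maximal_common_divisor (rat_add_monoid P) {x - e, y - e} d'"
        using less.hyps not_n[OF eP] by blast
      then show ?thesis
        using maximal_common_divisor_puiseux_shift[OF P less.prems(1,2) eP] by blast
    qed
  qed
  \<comment> \<open>Copies of \<open>n\<close> common to both elements are removed first; the size
    of \<open>x\<close> alone bounds their number.\<close>
  have "\<exists>d. maximal_common_divisor (rat_add_monoid P) {x, y} d" if "x \<in> P" "y \<in> P" for x y
    using that
  proof (induction "nat \<lfloor>x / n\<rfloor>" arbitrary: x y rule: less_induct)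
    case less
    show ?case
    proof (cases "x - n \<in> P \<and> y - n \<in> P")
      case True
      then have "n \<le> x" using puiseux_monoidD(3)[OF P, of "x - n"] by simp
      then obtain d where "maximal_common_divisor (rat_add_monoid P) {x - n, y - n} d"
        using less.hyps[OF nat_floor_diff_less[OF n]] True by blast
      then show ?thesis
        using maximal_common_divisor_puiseux_shift[OF P less.prems nP] by blast
    next
      case False
      then show ?thesis by (rule no_n[OF less.prems])
    qed
  qed
  then show ?thesis unfolding P_def[symmetric] two_MCD_puiseux_iff by blast
qed

section \<open>From one generator to finitely many\<close>

lemma plus_finitely_generated_induct:
  assumes M: "puiseux_monoid M" and N: "puiseux_monoid N"
    and fg: "finitely_generated_monoid (rat_add_monoid N)"
    and base: "Q M"
    and step: "\<And>P n. puiseux_monoid P \<Longrightarrow> 0 \<le> n \<Longrightarrow> Q P \<Longrightarrow> Q (P + multiples n)"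
  shows "Q (M + N)"
proof -
  obtain A where A: "finite A" "A \<subseteq> N" "N = (\<lambda>H. submonoid H (rat_add_monoid N)) hull A"
    using fg unfolding finitely_generated_monoid_def by (auto simp: rat_add_monoid_def)
  \<comment> \<open>The induction only tracks some monoid \<open>K\<close> between \<open>A\<close>
    and \<open>N\<close>, so the hull of each partial set of generators need not be
    computed.\<close>
  have "\<exists>K. puiseux_monoid K \<and> A \<subseteq> K \<and> K \<subseteq> N \<and> Q (M + K)"
    using A(1,2)
  proof (induction A rule: finite_induct)
    case empty
    have "puiseux_monoid {0}" by (simp add: puiseux_monoid_iff)
    moreover have "M + {0} = M" using add_0_right[of M] unfolding set_zero .
    ultimately show ?case
      using base puiseux_monoidD(1)[OF N] by (intro exI[of _ "{0}"]) auto
  next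
    case (insert a A)
    then obtain K where K: "puiseux_monoid K" "A \<subseteq> K" "K \<subseteq> N" "Q (M + K)" by auto
    have a: "a \<in> N" "0 \<le> a" using insert.prems puiseux_monoidD(3)[OF N] by auto
    have "a - of_nat 1 * a \<in> K" by (simp add: puiseux_monoidD(1)[OF K(1)])
    then have "a \<in> K + multiples a" unfolding mem_plus_multiples_iff ..
    moreover have "K + multiples a \<subseteq> N + multiples a"
      using K(3) by (intro set_plus_mono2) auto
    then have "K + multiples a \<subseteq> N" by (simp add: plus_multiples_absorb[OF N a(1)])
    \<comment> \<open>Associativity regroups the sum as \<open>(M + K) + multiples a\<close>, to
      which \<open>step\<close> applies.\<close>
    moreover have "Q (M + (K + multiples a))"
      using step[OF puiseux_monoid_plus[OF M K(1)] a(2) K(4)] by (simp add: add.assoc)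
    ultimately show ?case
      using K(2) subset_plus_multiples[of K a] puiseux_monoid_plus[OF K(1) puiseux_monoid_multiples[OF a(2)]]
      by (intro exI[of _ "K + multiples a"]) auto
  qed
  then obtain K where K: "puiseux_monoid K" "A \<subseteq> K" "K \<subseteq> N" "Q (M + K)" by blast
  have "submonoid K (rat_add_monoid N)"
    using K(1,3) by (auto simp: submonoid_def rat_add_monoid_def puiseux_monoid_iff)
  \<comment> \<open>For the full generating set, minimality of the hull forces \<open>K\<close> to
    be all of \<open>N\<close>.\<close>
  then have "N \<subseteq> K" by (subst A(3)) (rule hull_minimal[OF K(2)])
  then show ?thesis using K(3,4) by simp
qed

theorem theorem3p1:
  fixes M N :: "rat set"
  assumes "puiseux_monoid M" and "puiseux_monoid N"
    and "finitely_generated_monoid (rat_add_monoid N)"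
  shows "(atomic_monoid (rat_add_monoid M) \<longrightarrow> atomic_monoid (rat_add_monoid (M + N))) \<and>
    (strongly_atomic (rat_add_monoid M) \<longrightarrow> strongly_atomic (rat_add_monoid (M + N)))"
proof (intro conjI impI)
  assume "atomic_monoid (rat_add_monoid M)"
  then show "atomic_monoid (rat_add_monoid (M + N))"
    by (rule plus_finitely_generated_induct[OF assms]) (rule atomic_monoid_plus_multiples)
next
  assume "strongly_atomic (rat_add_monoid M)"
  then show "strongly_atomic (rat_add_monoid (M + N))"
    by (rule plus_finitely_generated_induct[OF assms])
      (simp add: strongly_atomic_def atomic_monoid_plus_multiples two_MCD_plus_multiples)
qed

end
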